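(* Let $(G,\tau)$ be an abelian topological group and let $\tau_{\mathcal H}$ be the $k_{\mathbb T}$-extension of its Bohr topology $\tau^+$, where $\mathcal H$ is the set of all homomorphisms $f:G\to\mathbb T$ such that $f|_K$ is $\tau^+$-continuous for every $\tau^+$-compact $K\subseteq G$. Then $(G,\tau_{\mathcal H})$ is a $k_{\mathbb T}$-group and $\tau_{\mathcal H}$ is compatible with the duality $(G,\mathcal H)$, i.e. $(G,\tau_{\mathcal H})^\wedge=\mathcal H$. Further, $\tau_{\mathcal H}$ and $\tau^+$ have the same family of compact subsets of $G$.
   Context: All groups are abelian; $\mathbb T$ is the unit circle in $\mathbb C$. For a topological group $(G,\tau)$, $(G,\tau)^\wedge$ is the group of continuous homomorphisms $G\to\mathbb T$. The Bohr topology $\tau^+$ is the weakest topology on $G$ making all elements of $(G,\tau)^\wedge$ continuous; it is a precompact group topology. For a precompact group $(G,w)$, let $\mathcal H$ be the group of all homomorphisms $f:G\to\mathbb T$ such that $f|_K$ is $w$-continuous for every $w$-compact $K\subseteq G$. The $k_{\mathbb T}$-extension of $w$ is the weak topology $\tau_{\mathcal H}$ on $G$ relative to $\mathcal H$, i.e. the weakest topology making all elements of $\mathcal H$ continuous. A topological group $(G,\mu)$ is a $k_{\mathbb T}$-group if every homomorphism $f:G\to\mathbb T$ such that $f|_K$ is continuous for every compact $K\subseteq G$ is continuous. *)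

theory Defs
  imports "HOL-Analysis.Analysis" "HOL-Algebra.Group"
begin

definition circle_group :: "complex monoid" where
  "circle_group = \<lparr>carrier = sphere 0 1, mult = (*), one = 1\<rparr>"

abbreviation circle_topology :: "complex topology" where
  "circle_topology \<equiv> top_of_set (sphere 0 1)"

lemma comm_group_circle_group: "comm_group circle_group"
proof (rule comm_groupI)
  fix x assume "x \<in> carrier circle_group"
  then have "norm x = 1" by (simp add: circle_group_def)
  moreover from this have "x \<noteq> 0" by auto
  ultimately have "inverse x \<in> carrier circle_group" "inverse x \<otimes>\<^bsub>circle_group\<^esub> x = \<one>\<^bsub>circle_group\<^esub>"
    by (auto simp: circle_group_def norm_inverse)
  then show "\<exists>y\<in>carrier circle_group. y \<otimes>\<^bsub>circle_group\<^esub> x = \<one>\<^bsub>circle_group\<^esub>"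
    by blast
qed (auto simp: circle_group_def norm_mult)

text \<open>No separation axiom is part of the notion of a topological group.\<close>

definition topological_ab_group :: "('a, 'b) monoid_scheme \<Rightarrow> 'a topology \<Rightarrow> bool" where
  "topological_ab_group G T \<longleftrightarrow>
     comm_group G \<and> topspace T = carrier G \<and>
     continuous_map (prod_topology T T) T (\<lambda>(x, y). x \<otimes>\<^bsub>G\<^esub> y) \<and>
     continuous_map T T (\<lambda>x. inv\<^bsub>G\<^esub> x)"

text \<open>Homomorphisms are taken extensional, so that each homomorphism on the carrier
  is represented by exactly one HOL function.\<close>

definition circle_homs :: "('a, 'b) monoid_scheme \<Rightarrow> ('a \<Rightarrow> complex) set" where
  "circle_homs G = hom G circle_group \<inter> extensional (carrier G)"

definition dual_group :: "('a, 'b) monoid_scheme \<Rightarrow> 'a topology \<Rightarrow> ('a \<Rightarrow> complex) set" where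
  "dual_group G T = {f \<in> circle_homs G. continuous_map T circle_topology f}"

text \<open>The set \<open>X\<close> itself is added to the subbase so that the topology lives on \<open>X\<close>
  even for an empty family; the three lemmas below say that this is the weakest
  topology on \<open>X\<close> making all members of the family continuous.\<close>

definition weak_topology :: "'a set \<Rightarrow> 'b topology \<Rightarrow> ('a \<Rightarrow> 'b) set \<Rightarrow> 'a topology" where
  "weak_topology X Y F =
     topology_generated_by (insert X {{x \<in> X. f x \<in> U} | f U. f \<in> F \<and> openin Y U})"

lemma topspace_weak_topology: "topspace (weak_topology X Y F) = X"
  unfolding weak_topology_def topology_generated_by_topspace by blast

lemma continuous_map_weak_topology:
  assumes "f \<in> F" "f \<in> X \<rightarrow> topspace Y"
  shows "continuous_map (weak_topology X Y F) Y f"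
  unfolding continuous_map_def topspace_weak_topology
proof (intro conjI allI impI)
  fix U assume "openin Y U"
  with assms(1) show "openin (weak_topology X Y F) {x \<in> X. f x \<in> U}"
    unfolding weak_topology_def by (intro topology_generated_by_Basis) blast
qed (use assms(2) in auto)

lemma weak_topology_weakest:
  assumes "topspace T = X" and "\<And>f. f \<in> F \<Longrightarrow> continuous_map T Y f"
    and "openin (weak_topology X Y F) U"
  shows "openin T U"
proof -
  have "openin T V" if "V \<in> insert X {{x \<in> X. f x \<in> U} | f U. f \<in> F \<and> openin Y U}" for V
    using that assms(1,2) by (auto simp: continuous_map_def)
  then show ?thesis
    using assms(3) generate_topology_on_coarsest[OF istopology_openin[of T]]
    unfolding weak_topology_def openin_topology_generated_by_iff by blast
qed

definition bohr_topology :: "('a, 'b) monoid_scheme \<Rightarrow> 'a topology \<Rightarrow> 'a topology" where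
  "bohr_topology G T = weak_topology (carrier G) circle_topology (dual_group G T)"

definition continuous_on_compacts :: "'a topology \<Rightarrow> ('a \<Rightarrow> complex) \<Rightarrow> bool" where
  "continuous_on_compacts T f \<longleftrightarrow>
     (\<forall>K. compactin T K \<longrightarrow> continuous_map (subtopology T K) circle_topology f)"

definition kT_homs :: "('a, 'b) monoid_scheme \<Rightarrow> 'a topology \<Rightarrow> ('a \<Rightarrow> complex) set" where
  "kT_homs G w = {f \<in> circle_homs G. continuous_on_compacts w f}"

definition kT_extension :: "('a, 'b) monoid_scheme \<Rightarrow> 'a topology \<Rightarrow> 'a topology" where
  "kT_extension G w = weak_topology (carrier G) circle_topology (kT_homs G w)"

definition kT_group :: "('a, 'b) monoid_scheme \<Rightarrow> 'a topology \<Rightarrow> bool" where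
  "kT_group G T \<longleftrightarrow> topological_ab_group G T \<and>
     (\<forall>f \<in> circle_homs G. continuous_on_compacts T f \<longrightarrow> continuous_map T circle_topology f)"

end

theory Submission
  imports Defs
begin

text \<open>A map into a weak topology is continuous iff its composites with the defining family are.
  Applied to the inclusion of a \<open>\<tau>\<^sup>+\<close>-compact set \<open>K\<close>, this shows that \<open>\<tau>\<^sub>\<H>\<close> and \<open>\<tau>\<^sup>+\<close> agree
  on \<open>K\<close>, so the two topologies have the same compact sets and the same homomorphisms
  continuous on compact sets. Since \<open>\<tau>\<^sub>\<H>\<close> makes all of \<open>\<H>\<close> continuous, everything follows; in
  particular no duality theorem for precompact groups is involved.\<close>

lemma continuous_map_into_weak_topology:
  assumes "g \<in> topspace Z \<rightarrow> X" and "\<And>f. f \<in> F \<Longrightarrow> continuous_map Z Y (\<lambda>z. f (g z))"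
  shows "continuous_map Z (weak_topology X Y F) g"
  unfolding weak_topology_def
proof (rule continuous_on_generated_topo)
  fix U assume "U \<in> insert X {{x \<in> X. f x \<in> U} | f U. f \<in> F \<and> openin Y U}"
  then consider "U = X" | f V where "U = {x \<in> X. f x \<in> V}" "f \<in> F" "openin Y V"
    by blast
  then show "openin Z (g -` U \<inter> topspace Z)"
  proof cases
    case 1
    then have "g -` U \<inter> topspace Z = topspace Z"
      using assms(1) by blast
    then show ?thesis
      by simp
  next
    case 2
    then have "g -` U \<inter> topspace Z = {z \<in> topspace Z. f (g z) \<in> V}"
      using assms(1) by blast
    then show ?thesis
      using openin_continuous_map_preimage[OF assms(2)] 2 by auto
  qed
next
  show "g ` topspace Z \<subseteq> \<Union> (insert X {{x \<in> X. f x \<in> U} | f U. f \<in> F \<and> openin Y U})"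
    using assms(1) by blast
qed

lemma continuous_map_mult:
  fixes f g :: "'a \<Rightarrow> 'b::real_normed_algebra"
  shows "\<lbrakk>continuous_map X euclidean f; continuous_map X euclidean g\<rbrakk>
    \<Longrightarrow> continuous_map X euclidean (\<lambda>x. f x * g x)"
  by (simp add: continuous_map_atin tendsto_mult)

lemma continuous_map_inverse:
  fixes f :: "'a \<Rightarrow> 'b::real_normed_div_algebra"
  shows "\<lbrakk>continuous_map X euclidean f; \<And>x. x \<in> topspace X \<Longrightarrow> f x \<noteq> 0\<rbrakk>
    \<Longrightarrow> continuous_map X euclidean (\<lambda>x. inverse (f x))"
  by (simp add: continuous_map_atin tendsto_inverse)

lemma hom_circle_group_memD:
  assumes "f \<in> hom G circle_group"
  shows "x \<in> carrier G \<Longrightarrow> f x \<in> sphere 0 1"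
    and "x \<in> carrier G \<Longrightarrow> y \<in> carrier G \<Longrightarrow> f (x \<otimes>\<^bsub>G\<^esub> y) = f x * f y"
  using hom_in_carrier[OF assms, of x] hom_mult[OF assms, of x y]
  by (simp_all add: circle_group_def)

text \<open>The right-hand side uses the inverse of the field of complex numbers, so that continuity
  of inversion away from 0 can be applied to it.\<close>

lemma hom_circle_group_inv:
  assumes "group G" "f \<in> hom G circle_group" "x \<in> carrier G"
  shows "f (inv\<^bsub>G\<^esub> x) = inverse (f x)"
proof -
  interpret group G by fact
  have "f \<one>\<^bsub>G\<^esub> = 1"
    using hom_one[OF assms(2) assms(1)] comm_group_circle_group
    by (simp add: circle_group_def comm_group_def)
  then have "f (inv\<^bsub>G\<^esub> x) * f x = 1"
    using hom_circle_group_memD(2)[OF assms(2), of "inv\<^bsub>G\<^esub> x" x] assms(3) by simp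
  then show ?thesis
    by (metis inverse_unique mult.commute)
qed

text \<open>Each member of \<open>F\<close> carries the group operations to multiplication and
  inversion of complex numbers, which are continuous on the circle; the universal property of the
  weak topology transfers this to \<open>G\<close>.\<close>

lemma topological_ab_group_weak_topology:
  assumes "comm_group G" and F: "F \<subseteq> hom G circle_group"
  shows "topological_ab_group G (weak_topology (carrier G) circle_topology F)"
proof -
  interpret comm_group G by fact
  let ?W = "weak_topology (carrier G) circle_topology F"
  have sph: "f x \<in> sphere 0 1" if "f \<in> F" "x \<in> carrier G" for f x
    using hom_circle_group_memD(1)[of f G x] F that by auto
  \<comment> \<open>The codomain is enlarged from the circle to the plane, where the limit laws for
    products and inverses live; \<open>sph\<close> later brings the values back to the
    circle.\<close>
  have cont: "continuous_map ?W euclidean f" if "f \<in> F" for f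
  proof -
    have "f \<in> carrier G \<rightarrow> topspace circle_topology"
      using sph[OF that] by simp
    from continuous_map_weak_topology[OF that this] show ?thesis
      by (rule continuous_map_into_fulltopology)
  qed
  have "continuous_map (prod_topology ?W ?W) ?W (\<lambda>(x, y). x \<otimes>\<^bsub>G\<^esub> y)"
  proof (rule continuous_map_into_weak_topology)
    fix f assume f: "f \<in> F"
    have "continuous_map (prod_topology ?W ?W) euclidean (\<lambda>z. f (fst z) * f (snd z))"
      using continuous_map_compose[OF continuous_map_fst cont[OF f]]
        continuous_map_compose[OF continuous_map_snd cont[OF f]]
      by (intro continuous_map_mult) (auto simp: o_def)
    then have "continuous_map (prod_topology ?W ?W) euclidean (\<lambda>z. f (case z of (x, y) \<Rightarrow> x \<otimes>\<^bsub>G\<^esub> y))"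
      using hom_circle_group_memD(2)[of f G] F f
      by (elim continuous_map_eq) (auto simp: topspace_weak_topology)
    then show "continuous_map (prod_topology ?W ?W) circle_topology
        (\<lambda>z. f (case z of (x, y) \<Rightarrow> x \<otimes>\<^bsub>G\<^esub> y))"
      using sph[OF f] by (auto simp: continuous_map_in_subtopology topspace_weak_topology
          simp del: mem_sphere mem_sphere_0)
  qed (auto simp: topspace_weak_topology)
  moreover have "continuous_map ?W ?W (\<lambda>x. inv\<^bsub>G\<^esub> x)"
  proof (rule continuous_map_into_weak_topology)
    fix f assume f: "f \<in> F"
    have "f x \<noteq> 0" if "x \<in> carrier G" for x
      using sph[OF f that] by auto
    then have "continuous_map ?W euclidean (\<lambda>x. inverse (f x))"
      using cont[OF f] by (intro continuous_map_inverse) (auto simp: topspace_weak_topology)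
    then have "continuous_map ?W euclidean (\<lambda>x. f (inv\<^bsub>G\<^esub> x))"
      using hom_circle_group_inv[OF is_group, of f] F f
      by (elim continuous_map_eq) (auto simp: topspace_weak_topology)
    then show "continuous_map ?W circle_topology (\<lambda>x. f (inv\<^bsub>G\<^esub> x))"
      using sph[OF f] by (auto simp: continuous_map_in_subtopology topspace_weak_topology
          simp del: mem_sphere mem_sphere_0)
  qed (auto simp: topspace_weak_topology)
  ultimately show ?thesis
    using assms(1) by (simp add: topological_ab_group_def topspace_weak_topology)
qed

text \<open>The family defining \<open>w\<close> is part of the family defining its extension.
  Continuity of \<open>id\<close> expresses that the extension is finer, in a form that can be
  composed and used to map compact sets.\<close>

lemma kT_extension_finer:
  assumes "w = weak_topology (carrier G) circle_topology F"
    and "F \<subseteq> kT_homs G w"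
  shows "continuous_map (kT_extension G w) w id"
proof -
  have F: "f \<in> hom G circle_group" if "f \<in> F" for f
    using assms(2) that by (auto simp: kT_homs_def circle_homs_def)
  have "continuous_map (kT_extension G w) circle_topology f" if "f \<in> F" for f
    unfolding kT_extension_def
    using that assms(2) hom_circle_group_memD(1)[OF F[OF that]]
    by (intro continuous_map_weak_topology) auto
  then have "continuous_map (kT_extension G w) (weak_topology (carrier G) circle_topology F) id"
    by (intro continuous_map_into_weak_topology)
      (auto simp: kT_extension_def topspace_weak_topology)
  then show ?thesis
    using assms(1) by simp
qed

text \<open>Membership in \<open>kT_homs\<close> is precisely continuity on each such
  \<open>K\<close>, which is what the universal property asks of the inclusion of
  \<open>K\<close>.\<close>

lemma continuous_map_kT_extension_on_compact:
  assumes "topspace w = carrier G" "compactin w K"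
  shows "continuous_map (subtopology w K) (kT_extension G w) id"
  unfolding kT_extension_def
  using assms
  by (intro continuous_map_into_weak_topology)
    (auto simp: kT_homs_def continuous_on_compacts_def)

lemma compactin_kT_extension_iff:
  assumes "topspace w = carrier G" and "continuous_map (kT_extension G w) w id"
  shows "compactin (kT_extension G w) K \<longleftrightarrow> compactin w K"
proof
  assume "compactin (kT_extension G w) K"
  then show "compactin w K"
    using image_compactin[OF _ assms(2)] by simp
next
  assume K: "compactin w K"
  \<comment> \<open>Regarded as a subset of its own subspace, \<open>K\<close> can be mapped by its
    inclusion, which is continuous even into the finer topology.\<close>
  then have "compactin (subtopology w K) K"
    by (simp add: compactin_subtopology)
  then show "compactin (kT_extension G w) K"
    using image_compactin[OF _ continuous_map_kT_extension_on_compact[OF assms(1) K]] by simp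
qed

text \<open>This makes the extension idempotent: on a \<open>w\<close>-compact \<open>K\<close>,
  which is also compact for the extension, \<open>f\<close> factors through the identity from
  \<open>K\<close> with the topology of \<open>w\<close> to \<open>K\<close> with that of the
  extension.\<close>

lemma continuous_on_compacts_kT_extension:
  assumes "topspace w = carrier G" and "continuous_map (kT_extension G w) w id"
    and "continuous_on_compacts (kT_extension G w) f"
  shows "continuous_on_compacts w f"
  unfolding continuous_on_compacts_def
proof (intro allI impI)
  fix K assume K: "compactin w K"
  then have "continuous_map (subtopology w K) (subtopology (kT_extension G w) K) id"
    using continuous_map_kT_extension_on_compact[OF assms(1) K]
    by (auto simp: continuous_map_in_subtopology)
  moreover have "continuous_map (subtopology (kT_extension G w) K) circle_topology f"
    using assms(3) K compactin_kT_extension_iff[OF assms(1,2)]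
    by (simp add: continuous_on_compacts_def)
  ultimately show "continuous_map (subtopology w K) circle_topology f"
    using continuous_map_compose by fastforce
qed

theorem theorem3p7:
  fixes G :: "('a, 'b) monoid_scheme" and \<tau> :: "'a topology"
  assumes "topological_ab_group G \<tau>"
  shows "kT_group G (kT_extension G (bohr_topology G \<tau>)) \<and>
         dual_group G (kT_extension G (bohr_topology G \<tau>)) = kT_homs G (bohr_topology G \<tau>) \<and>
         {K. compactin (kT_extension G (bohr_topology G \<tau>)) K} =
         {K. compactin (bohr_topology G \<tau>) K}"
proof -
  let ?w = "bohr_topology G \<tau>"
  let ?H = "kT_extension G ?w"
  have top: "topspace ?w = carrier G"
    by (simp add: bohr_topology_def topspace_weak_topology)
  have circle: "f \<in> carrier G \<rightarrow> topspace circle_topology" if "f \<in> circle_homs G" for f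
    using that hom_circle_group_memD(1)[of f G] by (auto simp: circle_homs_def)
  \<comment> \<open>Characters of \<tau> are continuous for the Bohr topology by construction, hence
    on all its compact sets. This is the hypothesis of \<open>kT_extension_finer\<close> with the
    dual group as \<open>F\<close>.\<close>
  have "dual_group G \<tau> \<subseteq> kT_homs G ?w"
  proof
    fix f assume f: "f \<in> dual_group G \<tau>"
    then have "f \<in> circle_homs G"
      by (simp add: dual_group_def)
    then show "f \<in> kT_homs G ?w"
      using continuous_map_weak_topology[OF f circle]
      by (simp add: kT_homs_def continuous_on_compacts_def bohr_topology_def
          continuous_map_from_subtopology)
  qed
  then have finer: "continuous_map ?H ?w id"
    by (rule kT_extension_finer[OF bohr_topology_def])
  have contH: "continuous_map ?H circle_topology f" if "f \<in> kT_homs G ?w" for f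
    unfolding kT_extension_def
    using that by (intro continuous_map_weak_topology circle) (auto simp: kT_homs_def)
  have homsH: "f \<in> kT_homs G ?w" if "f \<in> circle_homs G" "continuous_on_compacts ?H f" for f
    using continuous_on_compacts_kT_extension[OF top finer] that by (simp add: kT_homs_def)
  have "comm_group G"
    using assms by (simp add: topological_ab_group_def)
  then have "topological_ab_group G ?H"
    unfolding kT_extension_def
    by (rule topological_ab_group_weak_topology) (auto simp: kT_homs_def circle_homs_def)
  \<comment> \<open>Continuity on the compact sets of \<open>?H\<close> puts a homomorphism into
    \<open>kT_homs G ?w\<close> by \<open>homsH\<close>, and there it is continuous by
    \<open>contH\<close>.\<close>
  then have "kT_group G ?H"
    using homsH contH by (simp add: kT_group_def)
  \<comment> \<open>Both sides are subsets of \<open>circle_homs G\<close>, so only the continuity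
    conditions have to be compared; a globally continuous map is continuous on compact sets, so
    \<open>homsH\<close> applies again.\<close>
  moreover have "dual_group G ?H = kT_homs G ?w"
  proof
    show "dual_group G ?H \<subseteq> kT_homs G ?w"
      using homsH
      by (auto simp: dual_group_def continuous_on_compacts_def continuous_map_from_subtopology)
    show "kT_homs G ?w \<subseteq> dual_group G ?H"
      using contH by (auto simp: dual_group_def kT_homs_def)
  qed
  ultimately show ?thesis
    using compactin_kT_extension_iff[OF top finer] by simp
qed

end
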